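(* Let $R$ be a ring with $1\neq0$, let $F$ be a field, and let $\lambda:R^+\to F^*$ be a right primitive linear character. Suppose $R$ is finite. Then $\lambda$ is also left primitive.
   Context: $R^+$ is the additive group of $R$ (which need not be commutative). A group homomorphism (linear character) $\lambda:R^+\to F^*$ is right (resp. left) primitive if the only right (resp. left) ideal of $R$ contained in the kernel of $\lambda$ is $(0)$. *)

theory Defs
  imports "HOL-Algebra.Ideal"
begin

locale right_ideal = additive_subgroup I R + ring R for I and R (structure) +
  assumes r_closed: "\<lbrakk>a \<in> I; x \<in> carrier R\<rbrakk> \<Longrightarrow> a \<otimes> x \<in> I"

locale left_ideal = additive_subgroup I R + ring R for I and R (structure) +
  assumes l_closed: "\<lbrakk>a \<in> I; x \<in> carrier R\<rbrakk> \<Longrightarrow> x \<otimes> a \<in> I"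

(* Values of a character outside the carrier of R are unconstrained. *)
definition linear_characters ::
    "('a, 'm) ring_scheme \<Rightarrow> ('b, 'n) ring_scheme \<Rightarrow> ('a \<Rightarrow> 'b) set"
  where "linear_characters R F = hom (add_monoid R) (units_of F)"

definition right_primitive ::
    "('a, 'm) ring_scheme \<Rightarrow> ('b, 'n) ring_scheme \<Rightarrow> ('a \<Rightarrow> 'b) \<Rightarrow> bool"
  where "right_primitive R F \<chi> \<longleftrightarrow>
    (\<forall>I. right_ideal I R \<and> I \<subseteq> kernel (add_monoid R) (units_of F) \<chi> \<longrightarrow> I = {\<zero>\<^bsub>R\<^esub>})"

definition left_primitive ::
    "('a, 'm) ring_scheme \<Rightarrow> ('b, 'n) ring_scheme \<Rightarrow> ('a \<Rightarrow> 'b) \<Rightarrow> bool"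
  where "left_primitive R F \<chi> \<longleftrightarrow>
    (\<forall>I. left_ideal I R \<and> I \<subseteq> kernel (add_monoid R) (units_of F) \<chi> \<longrightarrow> I = {\<zero>\<^bsub>R\<^esub>})"

end

theory Submission
  imports Defs "HOL-Algebra.Multiplicative_Group"
begin

text \<open>
  The characters \<open>x \<mapsto> \<chi> (a x)\<close>, for \<open>a \<in> R\<close>, are pairwise distinct: the elements \<open>a\<close> for which
  \<open>\<chi> (a x) = 1\<close> for all \<open>x\<close> form a right ideal inside the kernel of \<open>\<chi>\<close>. By Dedekind's lemma
  these \<open>|R|\<close> characters are linearly independent functions on a set with \<open>|R|\<close> elements, so
  they separate points. But they do not separate \<open>0\<close> from the elements of a left ideal inside
  the kernel.
\<close>

text \<open>Gaussian elimination by induction on \<open>S\<close>. If some \<open>f u\<close> is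
  nonzero at the new point \<open>s\<close>, multiples of it clear the value at \<open>s\<close>
  from all other functions. This uses up one point and one function, so the strict inequality of
  cardinalities survives.\<close>

lemma (in field) exists_linear_relation:
  assumes "finite S" "finite T" "card S < card T"
    and "\<And>t x. t \<in> T \<Longrightarrow> x \<in> S \<Longrightarrow> f t x \<in> carrier R"
  shows "\<exists>c \<in> T \<rightarrow> carrier R. (\<exists>t\<in>T. c t \<noteq> \<zero>) \<and> (\<forall>x\<in>S. (\<Oplus>t\<in>T. c t \<otimes> f t x) = \<zero>)"
  using assms
proof (induction S arbitrary: T f rule: finite_induct)
  case empty
  then have "T \<noteq> {}" by auto
  \<comment> \<open>With no points to vanish at, any nonzero coefficients serve.\<close>
  then show ?case by (intro bexI[of _ "\<lambda>_. \<one>"]) auto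
next
  case (insert s S)
  show ?case
  proof (cases "\<forall>t\<in>T. f t s = \<zero>")
    case True
    \<comment> \<open>Every function vanishes at \<open>s\<close>, so a relation on \<open>S\<close>
      extends to \<open>s\<close> without giving up a function.\<close>
    obtain c where c: "c \<in> T \<rightarrow> carrier R" "\<exists>t\<in>T. c t \<noteq> \<zero>"
      "\<forall>x\<in>S. (\<Oplus>t\<in>T. c t \<otimes> f t x) = \<zero>"
      using insert.IH[of T f] insert.prems insert.hyps by auto
    have "(\<Oplus>t\<in>T. c t \<otimes> f t s) = (\<Oplus>t\<in>T. \<zero>)"
      using True c(1) by (intro finsum_cong') (auto simp: Pi_iff)
    then show ?thesis using c by (intro bexI[of _ c]) auto
  next
    case False
    then obtain u where u: "u \<in> T" "f u s \<noteq> \<zero>" by auto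
    define T' where "T' = T - {u}"
    have T': "finite T'" "u \<notin> T'" "T = insert u T'" "card S < card T'"
      using u insert.prems insert.hyps by (auto simp: T'_def)
    \<comment> \<open>The multiplier of the row operation: \<open>f t\<close> plus
      \<open>k t\<close> times the pivot \<open>f u\<close> vanishes at \<open>s\<close>.\<close>
    define k where "k t = \<ominus> (f t s \<otimes> inv (f u s))" for t
    have fc: "f t x \<in> carrier R" if "t \<in> T" "x \<in> insert s S" for t x
      using insert.prems that by auto
    have us: "f u s \<in> Units R" using u fc field_Units by auto
    have k: "k t \<in> carrier R" if "t \<in> T" for t
      using fc that us by (auto simp: k_def)
    obtain c where c: "c \<in> T' \<rightarrow> carrier R" "\<exists>t\<in>T'. c t \<noteq> \<zero>"
      "\<forall>x\<in>S. (\<Oplus>t\<in>T'. c t \<otimes> (f t x \<oplus> k t \<otimes> f u x)) = \<zero>"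
      using insert.IH[of T' "\<lambda>t x. f t x \<oplus> k t \<otimes> f u x"] T' fc k by auto
    have cc: "c t \<in> carrier R" if "t \<in> T'" for t using c(1) that by auto
    \<comment> \<open>Undoing the row operations: the coefficient of \<open>u\<close> collects all
      multiples of \<open>f u\<close> that the eliminated functions carry. On \<open>T'\<close> the
      old coefficients stay, so the relation remains nontrivial.\<close>
    define d where "d = c(u := \<Oplus>t\<in>T'. c t \<otimes> k t)"
    have du: "(\<Oplus>t\<in>T'. c t \<otimes> k t) \<in> carrier R"
      using cc k T'(3) by (intro finsum_closed) auto
    have dc: "d \<in> T \<rightarrow> carrier R"
      using du cc by (auto simp: d_def T'(3))
    have sum: "(\<Oplus>t\<in>T. d t \<otimes> f t x) = (\<Oplus>t\<in>T'. c t \<otimes> (f t x \<oplus> k t \<otimes> f u x))"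
      if x: "x \<in> insert s S" for x
    proof -
      have "(\<Oplus>t\<in>T. d t \<otimes> f t x) = d u \<otimes> f u x \<oplus> (\<Oplus>t\<in>T'. d t \<otimes> f t x)"
        unfolding T'(3) using T' dc fc x by (intro finsum_insert) auto
      also have "(\<Oplus>t\<in>T'. d t \<otimes> f t x) = (\<Oplus>t\<in>T'. c t \<otimes> f t x)"
        using T' cc fc x by (intro finsum_cong') (auto simp: d_def)
      also have "d u \<otimes> f u x = (\<Oplus>t\<in>T'. c t \<otimes> k t \<otimes> f u x)"
        unfolding d_def using T' cc k fc x by (simp add: finsum_ldistr Pi_iff)
      also have "\<dots> \<oplus> (\<Oplus>t\<in>T'. c t \<otimes> f t x) = (\<Oplus>t\<in>T'. c t \<otimes> k t \<otimes> f u x \<oplus> c t \<otimes> f t x)"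
        using T' cc k fc x by (intro finsum_addf[symmetric]) auto
      also have "\<dots> = (\<Oplus>t\<in>T'. c t \<otimes> (f t x \<oplus> k t \<otimes> f u x))"
        using T' cc k fc x by (intro finsum_cong') (auto simp: r_distr m_assoc a_comm)
      finally show ?thesis .
    qed
    \<comment> \<open>The induction hypothesis says nothing about \<open>s\<close>; there each
      summand vanishes by the choice of \<open>k\<close>.\<close>
    have "(\<Oplus>t\<in>T'. c t \<otimes> (f t s \<oplus> k t \<otimes> f u s)) = (\<Oplus>t\<in>T'. \<zero>)"
    proof (intro finsum_cong')
      fix t assume t: "t \<in> T'"
      have "k t \<otimes> f u s = \<ominus> f t s"
        using us t T' fc by (simp add: k_def l_minus m_assoc)
      then show "c t \<otimes> (f t s \<oplus> k t \<otimes> f u s) = \<zero>"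
        using t T' cc fc by (simp add: r_neg)
    qed auto
    then have "\<forall>x\<in>insert s S. (\<Oplus>t\<in>T. d t \<otimes> f t x) = \<zero>"
      using sum c(3) by auto
    moreover have "\<exists>t\<in>T. d t \<noteq> \<zero>"
      using c(2) T' by (auto simp: d_def)
    ultimately show ?thesis using dc by (intro bexI[of _ d]) auto
  qed
qed

text \<open>Dedekind's argument: take the relation at a product of \<open>x\<close> and
  \<open>y\<close>, and subtract \<open>\<phi> u y\<close> times the relation at \<open>x\<close>.
  The term of \<open>u\<close> cancels, leaving a relation over the smaller index set, to which
  induction applies.\<close>

lemma (in field) characters_linearly_independent:
  assumes "finite T" "monoid G"
    and "\<And>t. t \<in> T \<Longrightarrow> \<phi> t \<in> hom G (units_of R)"
    and "\<And>t u. t \<in> T \<Longrightarrow> u \<in> T \<Longrightarrow> t \<noteq> u \<Longrightarrow> \<exists>x\<in>carrier G. \<phi> t x \<noteq> \<phi> u x"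
    and "c \<in> T \<rightarrow> carrier R"
    and "\<And>x. x \<in> carrier G \<Longrightarrow> (\<Oplus>t\<in>T. c t \<otimes> \<phi> t x) = \<zero>"
    and "t \<in> T"
  shows "c t = \<zero>"
  using assms(1,3-)
proof (induction T arbitrary: c t rule: finite_induct)
  case empty
  then show ?case by simp
next
  case (insert u T)
  interpret G: monoid G by fact
  have U: "\<phi> t x \<in> Units R" if "t \<in> insert u T" "x \<in> carrier G" for t x
    using insert.prems(1)[OF that(1)] that(2) by (auto simp: hom_def units_of_def)
  have \<phi>: "\<phi> t x \<in> carrier R" if "t \<in> insert u T" "x \<in> carrier G" for t x
    using U[OF that] by auto
  have mult: "\<phi> t (x \<otimes>\<^bsub>G\<^esub> y) = \<phi> t x \<otimes> \<phi> t y"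
    if "t \<in> insert u T" "x \<in> carrier G" "y \<in> carrier G" for t x y
    using insert.prems(1)[OF that(1)] that(2,3) by (auto simp: hom_def units_of_def)
  have c: "c t \<in> carrier R" if "t \<in> insert u T" for t
    using insert.prems(3) that by auto
  have zero: "c t = \<zero>" if t: "t \<in> T" for t
  proof -
    have "t \<noteq> u" using t insert.hyps by auto
    then obtain y where y: "y \<in> carrier G" "\<phi> t y \<noteq> \<phi> u y"
      using insert.prems(2)[of t u] t by auto
    \<comment> \<open>Coefficients of the shortened relation. The factor is zero at \<open>u\<close>
      but not at the chosen \<open>t\<close>, since \<open>y\<close> separates the two characters;
      hence \<open>d t = \<zero>\<close> will force \<open>c t = \<zero>\<close>.\<close>
    define d where "d t = c t \<otimes> (\<phi> t y \<ominus> \<phi> u y)" for t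
    have d: "d t \<in> carrier R" if "t \<in> insert u T" for t
      using c \<phi> y that by (auto simp: d_def)
    have "(\<Oplus>t\<in>T. d t \<otimes> \<phi> t x) = \<zero>" if x: "x \<in> carrier G" for x
    proof -
      have "d u = \<zero>" using c \<phi> y by (simp add: d_def minus_eq r_neg)
      then have "(\<Oplus>t\<in>T. d t \<otimes> \<phi> t x) = (\<Oplus>t\<in>insert u T. d t \<otimes> \<phi> t x)"
        using insert.hyps d \<phi> x by (subst finsum_insert) auto
      also have "\<dots> = (\<Oplus>t\<in>insert u T. c t \<otimes> \<phi> t (x \<otimes>\<^bsub>G\<^esub> y) \<oplus>
          c t \<otimes> \<phi> t x \<otimes> (\<ominus> \<phi> u y))"
      proof (intro finsum_cong')
        fix t assume t: "t \<in> insert u T"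
        have carr: "c t \<in> carrier R" "\<phi> t x \<in> carrier R" "\<phi> t y \<in> carrier R" "\<phi> u y \<in> carrier R"
          using t c \<phi> x y by auto
        show "d t \<otimes> \<phi> t x = c t \<otimes> \<phi> t (x \<otimes>\<^bsub>G\<^esub> y) \<oplus> c t \<otimes> \<phi> t x \<otimes> (\<ominus> \<phi> u y)"
          unfolding d_def mult[OF t x y(1)] using carr
          by (simp add: minus_eq r_distr l_distr m_ac r_minus l_minus)
      qed (use c \<phi> x y in auto)
      also have "\<dots> = (\<Oplus>t\<in>insert u T. c t \<otimes> \<phi> t (x \<otimes>\<^bsub>G\<^esub> y)) \<oplus>
          (\<Oplus>t\<in>insert u T. c t \<otimes> \<phi> t x \<otimes> (\<ominus> \<phi> u y))"
        using c \<phi> x y by (intro finsum_addf) auto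
      also have "(\<Oplus>t\<in>insert u T. c t \<otimes> \<phi> t x \<otimes> (\<ominus> \<phi> u y)) =
          (\<Oplus>t\<in>insert u T. c t \<otimes> \<phi> t x) \<otimes> (\<ominus> \<phi> u y)"
        using insert.hyps c \<phi> x y by (intro finsum_ldistr[symmetric]) auto
      finally show ?thesis
        using insert.prems(4) x y \<phi> by simp
    qed
    moreover have "d \<in> T \<rightarrow> carrier R" using d by auto
    ultimately have "d t = \<zero>"
      using t insert.prems(1,2) by (intro insert.IH[of d t]) blast+
    moreover have "\<phi> t y \<ominus> \<phi> u y \<noteq> \<zero>"
      using y \<phi> t by simp
    ultimately show ?thesis
      using c \<phi> t y by (auto simp: d_def integral_iff)
  qed
  \<comment> \<open>Only the term of \<open>u\<close> is left. Evaluated at the identity of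
    \<open>G\<close> it is \<open>c u\<close> times a unit.\<close>
  have "(\<Oplus>t\<in>T. c t \<otimes> \<phi> t \<one>\<^bsub>G\<^esub>) = (\<Oplus>t\<in>T. \<zero>)"
    using zero \<phi> by (intro finsum_cong') auto
  then have "c u \<otimes> \<phi> u \<one>\<^bsub>G\<^esub> = \<zero>"
    using insert.prems(4)[OF G.one_closed] insert.hyps c \<phi> by (subst (asm) finsum_insert) auto
  then have "c u = \<zero>"
    using c \<phi> U[of u "\<one>\<^bsub>G\<^esub>"] field_Units by (auto simp: integral_iff)
  then show ?case using zero insert.prems(5) by auto
qed

text \<open>With more characters than points of \<open>S\<close>, a nontrivial relation would hold
  on \<open>S\<close>. Since \<open>S\<close> represents every point of \<open>G\<close> as far as
  these characters can tell, the relation would hold on all of \<open>G\<close>, against linear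
  independence.\<close>

lemma (in field) card_characters_le:
  assumes "finite S" "finite T" "monoid G" "S \<subseteq> carrier G"
    and hom: "\<And>t. t \<in> T \<Longrightarrow> \<phi> t \<in> hom G (units_of R)"
    and inj: "\<And>t u. t \<in> T \<Longrightarrow> u \<in> T \<Longrightarrow> t \<noteq> u \<Longrightarrow> \<exists>x\<in>carrier G. \<phi> t x \<noteq> \<phi> u x"
    and rep: "\<And>x. x \<in> carrier G \<Longrightarrow> \<exists>s\<in>S. \<forall>t\<in>T. \<phi> t x = \<phi> t s"
  shows "card T \<le> card S"
proof (rule ccontr)
  assume "\<not> card T \<le> card S"
  then have less: "card S < card T" by simp
  have \<phi>: "\<phi> t x \<in> carrier R" if "t \<in> T" "x \<in> carrier G" for t x
    using hom[OF that(1)] that(2) Units_closed by (auto simp: hom_def units_of_def)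
  have "\<exists>c \<in> T \<rightarrow> carrier R. (\<exists>t\<in>T. c t \<noteq> \<zero>) \<and> (\<forall>x\<in>S. (\<Oplus>t\<in>T. c t \<otimes> \<phi> t x) = \<zero>)"
    using assms(1,2,4) less \<phi> by (intro exists_linear_relation) auto
  then obtain c where c: "c \<in> T \<rightarrow> carrier R" "\<exists>t\<in>T. c t \<noteq> \<zero>"
    "\<forall>x\<in>S. (\<Oplus>t\<in>T. c t \<otimes> \<phi> t x) = \<zero>"
    by blast
  have "(\<Oplus>t\<in>T. c t \<otimes> \<phi> t x) = \<zero>" if x: "x \<in> carrier G" for x
  proof -
    obtain s where s: "s \<in> S" "\<forall>t\<in>T. \<phi> t x = \<phi> t s" using rep[OF x] by auto
    then have "(\<Oplus>t\<in>T. c t \<otimes> \<phi> t x) = (\<Oplus>t\<in>T. c t \<otimes> \<phi> t s)"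
      using c(1) \<phi> assms(4) by (intro finsum_cong') (auto intro!: m_closed)
    then show ?thesis using c(3) s by simp
  qed
  then have "c t = \<zero>" if "t \<in> T" for t
    using characters_linearly_independent[of T G \<phi> c t] assms(2,3) hom inj c(1) that by blast
  then show False using c(2) by auto
qed

text \<open>Since \<open>\<chi>\<close> turns differences into quotients,
  \<open>a \<ominus> b\<close> lies in the right ideal \<open>I\<close> of all \<open>d\<close> with
  \<open>\<chi>\<close> trivial on every \<open>d \<otimes> x\<close>; primitivity makes
  \<open>I\<close> zero.\<close>

lemma right_primitive_translates_distinct:
  fixes R (structure)
  assumes "ring R" "field F" "\<chi> \<in> linear_characters R F" "right_primitive R F \<chi>"
    and ab: "a \<in> carrier R" "b \<in> carrier R"
    and eq: "\<And>x. x \<in> carrier R \<Longrightarrow> \<chi> (a \<otimes> x) = \<chi> (b \<otimes> x)"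
  shows "a = b"
proof -
  interpret R: ring R by fact
  interpret F: field F by fact
  interpret \<chi>: group_hom "add_monoid R" "units_of F" \<chi>
    using assms(3) R.a_group F.units_group
    by (auto simp: group_hom_def group_hom_axioms_def linear_characters_def)
  define I where "I = {d \<in> carrier R. \<forall>x\<in>carrier R. \<chi> (d \<otimes> x) = \<one>\<^bsub>units_of F\<^esub>}"
  have add: "\<chi> (x \<oplus> y) = \<chi> x \<otimes>\<^bsub>units_of F\<^esub> \<chi> y" if "x \<in> carrier R" "y \<in> carrier R" for x y
    using \<chi>.hom_mult that by simp
  have neg: "\<chi> (\<ominus> x) = inv\<^bsub>units_of F\<^esub> \<chi> x" if "x \<in> carrier R" for x
    using \<chi>.hom_inv that by (simp add: a_inv_def)
  have chi_closed: "\<chi> x \<in> carrier (units_of F)" if "x \<in> carrier R" for x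
    using \<chi>.hom_closed that by simp
  have one: "\<chi> \<zero> = \<one>\<^bsub>units_of F\<^esub>"
    using \<chi>.hom_one by simp
  have "right_ideal I R"
  proof (intro right_ideal.intro right_ideal_axioms.intro additive_subgroup.intro)
    show "subgroup I (add_monoid R)"
    proof (rule R.add.subgroupI)
      show "I \<noteq> {}" using one by (auto simp: I_def intro!: exI[of _ "\<zero>"])
    qed (auto simp: I_def R.l_distr R.l_minus add neg)
    show "x \<otimes> y \<in> I" if "x \<in> I" "y \<in> carrier R" for x y
      using that by (auto simp: I_def R.m_assoc)
  qed fact
  moreover have "I \<subseteq> kernel (add_monoid R) (units_of F) \<chi>"
  proof
    fix d assume "d \<in> I"
    \<comment> \<open>Taking \<open>x = \<one>\<close> in the definition of \<open>I\<close> puts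
      \<open>d\<close> itself into the kernel.\<close>
    then have "d \<in> carrier R" "\<chi> (d \<otimes> \<one>) = \<one>\<^bsub>units_of F\<^esub>"
      by (auto simp: I_def simp del: R.r_one)
    then show "d \<in> kernel (add_monoid R) (units_of F) \<chi>" by (simp add: kernel_def)
  qed
  ultimately have "I = {\<zero>}" using assms(4) by (auto simp: right_primitive_def)
  moreover have "a \<ominus> b \<in> I"
    using ab chi_closed by (auto simp: I_def R.minus_eq R.l_distr R.l_minus add neg eq)
  ultimately show ?thesis using ab by auto
qed

theorem corollary4p6:
  fixes R :: "('a, 'm) ring_scheme" and F :: "('b, 'n) ring_scheme" and \<chi> :: "'a \<Rightarrow> 'b"
  assumes "ring R" and "\<one>\<^bsub>R\<^esub> \<noteq> \<zero>\<^bsub>R\<^esub>"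
    and "field F"
    and "\<chi> \<in> linear_characters R F"
    and "right_primitive R F \<chi>"
    and "finite (carrier R)"
  shows "left_primitive R F \<chi>"
  unfolding left_primitive_def
proof (intro allI impI, elim conjE)
  fix I assume "left_ideal I R" and ker: "I \<subseteq> kernel (add_monoid R) (units_of F) \<chi>"
  interpret R: ring R by fact
  interpret F: field F by fact
  interpret I: left_ideal I R by fact
  have \<chi>: "\<chi> \<in> hom (add_monoid R) (units_of F)"
    using assms(4) by (simp add: linear_characters_def)
  have "b = \<zero>\<^bsub>R\<^esub>" if b: "b \<in> I" for b
  proof (rule ccontr)
    assume nz: "b \<noteq> \<zero>\<^bsub>R\<^esub>"
    have bR: "b \<in> carrier R" using b I.a_subset by auto
    \<comment> \<open>Both products lie in the left ideal, hence in the kernel, so no translate of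
      \<open>\<chi>\<close> separates \<open>b\<close> from zero.\<close>
    have "\<chi> (a \<otimes>\<^bsub>R\<^esub> b) = \<chi> (a \<otimes>\<^bsub>R\<^esub> \<zero>\<^bsub>R\<^esub>)" if "a \<in> carrier R" for a
    proof -
      have "a \<otimes>\<^bsub>R\<^esub> b \<in> I" "a \<otimes>\<^bsub>R\<^esub> \<zero>\<^bsub>R\<^esub> \<in> I"
        using I.l_closed b I.zero_closed that by auto
      then have "a \<otimes>\<^bsub>R\<^esub> b \<in> kernel (add_monoid R) (units_of F) \<chi>"
        "a \<otimes>\<^bsub>R\<^esub> \<zero>\<^bsub>R\<^esub> \<in> kernel (add_monoid R) (units_of F) \<chi>"
        using ker by blast+
      then show ?thesis by (simp add: kernel_def del: R.r_null)
    qed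
    \<comment> \<open>Zero can stand in for \<open>b\<close>, and it survives the removal of
      \<open>b\<close> because \<open>b\<close> is nonzero. So the translates, one for each element
      of \<open>R\<close>, are determined on one point fewer than \<open>R\<close> has.\<close>
    then have "\<exists>s\<in>carrier R - {b}. \<forall>a\<in>carrier R. \<chi> (a \<otimes>\<^bsub>R\<^esub> x) = \<chi> (a \<otimes>\<^bsub>R\<^esub> s)"
      if "x \<in> carrier R" for x
      using that nz by (intro bexI[of _ "if x = b then \<zero>\<^bsub>R\<^esub> else x"]) auto
    moreover have "(\<lambda>x. \<chi> (a \<otimes>\<^bsub>R\<^esub> x)) \<in> hom (add_monoid R) (units_of F)" if "a \<in> carrier R" for a
      using \<chi> that by (auto simp: hom_def R.r_distr)
    moreover have "\<exists>x\<in>carrier R. \<chi> (a \<otimes>\<^bsub>R\<^esub> x) \<noteq> \<chi> (a' \<otimes>\<^bsub>R\<^esub> x)"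
      if "a \<in> carrier R" "a' \<in> carrier R" "a \<noteq> a'" for a a'
      using right_primitive_translates_distinct[OF assms(1,3-5)] that by blast
    ultimately have "card (carrier R) \<le> card (carrier R - {b})"
      using assms(6) R.add.is_monoid
      by (intro F.card_characters_le[where G = "add_monoid R" and \<phi> = "\<lambda>a x. \<chi> (a \<otimes>\<^bsub>R\<^esub> x)"]) auto
    then show False
      using card_Diff1_less[OF assms(6) bR] by simp
  qed
  then show "I = {\<zero>\<^bsub>R\<^esub>}" using I.zero_closed by auto
qed

end
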